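(* Learning from complementary labels with the loss $\ell_{\mathrm{CL}}(\mathbf f(X),\widetilde Y):=\ell(\mathbf f(X),\widetilde Y)-\ell(\mathbf f(X),1-\widetilde Y)$ is equivalent to negative label smoothing with smooth rate $r_{\mathrm{CL}}\to-\infty$: $$\min_{f\in\mathcal F}\mathbb{E}_{(X,\widetilde Y)\sim\widetilde{\mathcal D}}\big[\ell_{\mathrm{CL}}(\mathbf f(X),\widetilde Y)\big]=\min_{f\in\mathcal F}\mathbb{E}_{(X,\widetilde Y)\sim\widetilde{\mathcal D}}\big[\ell(\mathbf f(X),\widetilde Y^{\mathrm{GLS},r_{\mathrm{CL}}\to-\infty})\big].$$
   Context: Binary classification: $(X,\widetilde Y)\sim\widetilde{\mathcal D}$ with $X\in\mathcal X$ and noisy label $\widetilde Y\in\{0,1\}$. A model $f$ assigns to each $x$ a probability vector $\mathbf f(x)=(\mathbf f(x)_0,\mathbf f(x)_1)$ (a softmax output); $\mathcal F$ is the hypothesis space of models under consideration. The loss is cross-entropy, $\ell(\mathbf f(x),y)=-\log \mathbf f(x)_y$, extended linearly to vector labels: $\ell(\mathbf f(x),\mathbf v)=-\sum_{k} v_k\log\mathbf f(x)_k$ for $\mathbf v\in\mathbb R^2$. Generalized label smoothing: for a label $y$ with one-hot vector $\mathbf y\in\mathbb R^2$ and smooth rate $r\in(-\infty,1]$, $\mathbf y^{\mathrm{GLS},r}=(1-r)\mathbf y+\frac r2\mathbf 1$ with $\mathbf 1$ the all-ones vector; $\widetilde Y^{\mathrm{GLS},r}$ is the smoothed version of $\widetilde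 Y$, so that $\ell(\mathbf f(X),\widetilde Y^{\mathrm{GLS},r})=(1-\frac r2)\,\ell(\mathbf f(X),\widetilde Y)+\frac r2\,\ell(\mathbf f(X),1-\widetilde Y)$. The case $r<0$ is called negative label smoothing. The smooth rate $r\to-\infty$ is understood as a limit after dividing by a positive factor depending only on $r$, which does not affect the minimization over $f$: dividing the smoothed loss by $1-\frac r2$ gives $\ell(\mathbf f(X),\widetilde Y)+\frac{r}{2-r}\,\ell(\mathbf f(X),1-\widetilde Y)$, whose coefficient $\frac{r}{2-r}$ tends to $-1$ as $r\to-\infty$ (dividing the smoothed label by $1-r$ instead gives the limit $\mathbf y-\frac12\mathbf 1$). *)

theory Defs
  imports "HOL-Probability.Probability"
begin

(* Labels live in the two-element type 2, whose elements are 0 and 1.  Its arithmetic is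
   modulo 2, so 1 - y is the complementary label (1 - 0 = 1 and 1 - 1 = 0). *)

definition ce :: "real^2 \<Rightarrow> 2 \<Rightarrow> real" where
  "ce p y = - ln (p $ y)"

(* The extension of the cross-entropy to vector labels, linear in the label. *)
definition ce_vec :: "real^2 \<Rightarrow> real^2 \<Rightarrow> real" where
  "ce_vec p v = - (\<Sum>k\<in>UNIV. v $ k * ln (p $ k))"

lemma ce_vec_one_hot: "ce_vec p (axis y 1) = ce p y"
  by (simp add: ce_vec_def ce_def axis_def if_distrib if_distribR cong: if_cong)

definition cl_loss :: "real^2 \<Rightarrow> 2 \<Rightarrow> real" where
  "cl_loss p y = ce p y - ce p (1 - y)"

(* Here axis y 1 is the one-hot vector of y, and the last 1 is the all-ones vector. *)
definition gls_label :: "real \<Rightarrow> 2 \<Rightarrow> real^2" where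
  "gls_label r y = (1 - r) *\<^sub>R axis y 1 + (r / 2) *\<^sub>R 1"

(* The label with smooth rate tending to minus infinity.  The smoothed label itself diverges;
   the limit is taken after division by 1 - r/2, which is positive for all r \<le> 1. *)
definition gls_limit_label :: "2 \<Rightarrow> real^2" where
  "gls_limit_label y = Lim at_bot (\<lambda>r. gls_label r y /\<^sub>R (1 - r / 2))"

(* A softmax output is a probability vector with strictly positive entries, so that the
   cross-entropy is finite (recall that ln 0 = 0 in HOL). *)
definition softmax_model :: "'x measure \<Rightarrow> ('x \<Rightarrow> real^2) \<Rightarrow> bool" where
  "softmax_model M f \<longleftrightarrow> f \<in> borel_measurable M \<and>
     (\<forall>x\<in>space M. (\<forall>k. 0 < f x $ k) \<and> (\<Sum>k\<in>UNIV. f x $ k) = 1)"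

definition cl_risk :: "('x \<times> 2) measure \<Rightarrow> ('x \<Rightarrow> real^2) \<Rightarrow> real" where
  "cl_risk D f = (\<integral>(x, y). cl_loss (f x) y \<partial>D)"

definition gls_risk :: "('x \<times> 2) measure \<Rightarrow> real \<Rightarrow> ('x \<Rightarrow> real^2) \<Rightarrow> real" where
  "gls_risk D r f = (\<integral>(x, y). ce_vec (f x) (gls_label r y) \<partial>D)"

definition gls_limit_risk :: "('x \<times> 2) measure \<Rightarrow> ('x \<Rightarrow> real^2) \<Rightarrow> real" where
  "gls_limit_risk D f = (\<integral>(x, y). ce_vec (f x) (gls_limit_label y) \<partial>D)"

end

theory Submission
  imports Defs "HOL-Real_Asymp.Real_Asymp"
begin

text \<open>
  The smoothed label divided by \<open>1 - r / 2\<close> equals \<open>e\<^sub>y + c e\<^bsub>1-y\<^esub>\<close> with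
  \<open>c = r / (2 - r)\<close>. As \<open>r\<close> tends to minus infinity, \<open>c\<close> tends to \<open>-1\<close> from above, so the limit
  label reproduces the complementary-label loss pointwise. Since the cross-entropy is nonnegative,
  the rescaled risks approach their limit from above, which is why their infima converge without
  any uniformity over the hypothesis space.
\<close>

text \<open>The bound \<open>ge\<close> keeps the infima above the limiting one. From above, a
  single index \<open>i\<close> with \<open>h i < a\<close> suffices, because \<open>g r i\<close>
  eventually drops below \<open>a\<close> too. An infimum of minus infinity only makes the lower
  half vacuous.\<close>

lemma tendsto_INF_from_above:
  fixes g :: "'a \<Rightarrow> 'b \<Rightarrow> 'c::{complete_linorder,linorder_topology}"
  assumes lim: "\<And>i. i \<in> I \<Longrightarrow> ((\<lambda>r. g r i) \<longlongrightarrow> h i) F"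
    and ge: "\<forall>\<^sub>F r in F. \<forall>i\<in>I. h i \<le> g r i"
  shows "((\<lambda>r. INF i\<in>I. g r i) \<longlongrightarrow> (INF i\<in>I. h i)) F"
proof (rule order_tendstoI)
  fix a assume "a < (INF i\<in>I. h i)"
  with ge show "\<forall>\<^sub>F r in F. a < (INF i\<in>I. g r i)"
    by (elim eventually_mono) (meson INF_mono order_less_le_trans)
next
  fix a assume "(INF i\<in>I. h i) < a"
  then obtain i where i: "i \<in> I" "h i < a"
    by (auto simp: INF_less_iff)
  from order_tendstoD(2)[OF lim[OF i(1)] i(2)]
  show "\<forall>\<^sub>F r in F. (INF i\<in>I. g r i) < a"
    by (rule eventually_mono) (use i(1) INF_less_iff in blast)
qed

lemma complement_neq: "(1::2) - y \<noteq> y"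
  using exhaust_2[of y] by auto

lemma UNIV_label: "(UNIV :: 2 set) = {y, 1 - y}"
proof -
  have "z = y \<or> z = 1 - y" for z
    using complement_neq[of y] exhaust_2[of y] exhaust_2[of z] exhaust_2[of "1 - y"] by metis
  then show ?thesis by blast
qed

lemma sum_label: "(\<Sum>k\<in>UNIV. f k) = f y + f (1 - y)"
  for f :: "2 \<Rightarrow> 'a::comm_monoid_add"
  by (subst UNIV_label[of y]) (simp add: complement_neq[symmetric])

lemma one_eq_axis_add: "(1 :: real^2) = axis y 1 + axis (1 - y) 1"
proof -
  \<comment> \<open>Making the complement opaque leaves only two facts for the entrywise check:
    \<open>y\<close> and \<open>z\<close> differ, and together they exhaust the type.\<close>
  obtain z where z: "z = 1 - y" by blast
  then have "z \<noteq> y" "UNIV = {y, z}"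
    using complement_neq UNIV_label by simp_all
  then show ?thesis
    unfolding vec_eq_iff z[symmetric] by (auto simp: axis_def)
qed

lemma gls_label_eq: "gls_label r y = (1 - r / 2) *\<^sub>R axis y 1 + (r / 2) *\<^sub>R axis (1 - y) 1"
proof -
  have "1 - r / 2 = (1 - r) + r / 2" by simp
  then show ?thesis
    unfolding gls_label_def one_eq_axis_add[of y]
    by (simp only: scaleR_add_left scaleR_add_right add.assoc)
qed

text \<open>Dividing by \<open>1 - r / 2\<close> normalizes the weight of the given label to 1, so
  all dependence on \<open>r\<close> sits in one coefficient. The bound \<open>r < 2\<close> makes
  the divisor positive.\<close>

lemma gls_label_scaled:
  assumes "r < 2"
  shows "gls_label r y /\<^sub>R (1 - r / 2) = axis y 1 + (r / (2 - r)) *\<^sub>R axis (1 - y) 1"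
proof -
  have "inverse (1 - r / 2) * (1 - r / 2) = 1" "inverse (1 - r / 2) * (r / 2) = r / (2 - r)"
    using assms by (simp_all add: field_simps)
  then show ?thesis
    by (simp only: gls_label_eq scaleR_add_right scaleR_scaleR scaleR_one)
qed

lemma gls_coeff_tendsto: "((\<lambda>r::real. r / (2 - r)) \<longlongrightarrow> -1) at_bot"
  by real_asymp

lemma gls_label_tendsto:
  "((\<lambda>r. gls_label r y /\<^sub>R (1 - r / 2)) \<longlongrightarrow> axis y 1 - axis (1 - y) 1) at_bot"
proof -
  have "((\<lambda>r::real. axis y 1 + (r / (2 - r)) *\<^sub>R axis (1 - y) 1)
      \<longlongrightarrow> axis y 1 + (-1) *\<^sub>R (axis (1 - y) 1 :: real^2)) at_bot"
    by (intro tendsto_intros gls_coeff_tendsto)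
  then have "((\<lambda>r::real. axis y 1 + (r / (2 - r)) *\<^sub>R axis (1 - y) 1)
      \<longlongrightarrow> axis y 1 - (axis (1 - y) 1 :: real^2)) at_bot"
    by simp
  moreover have "\<forall>\<^sub>F r in at_bot. axis y 1 + (r / (2 - r)) *\<^sub>R axis (1 - y) 1
      = gls_label r y /\<^sub>R (1 - r / 2)"
    using eventually_gt_at_bot[of "2::real"]
    by (rule eventually_mono) (use gls_label_scaled in auto)
  ultimately show ?thesis
    by (rule Lim_transform_eventually)
qed

text \<open>\<open>Lim\<close> is a choice operator; it is pinned down by convergence, since limits
  along the nontrivial filter \<open>at_bot\<close> are unique.\<close>

lemma gls_limit_label_eq: "gls_limit_label y = axis y 1 - axis (1 - y) 1"
  unfolding gls_limit_label_def
  by (rule tendsto_Lim) (use gls_label_tendsto in auto)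

lemma ce_vec_add: "ce_vec p (v + w) = ce_vec p v + ce_vec p w"
  by (simp add: ce_vec_def algebra_simps sum.distrib)

lemma ce_vec_scaleR: "ce_vec p (c *\<^sub>R v) = c * ce_vec p v"
  by (simp add: ce_vec_def sum_distrib_left mult.assoc)

lemma ce_vec_gls_limit_label: "ce_vec p (gls_limit_label y) = cl_loss p y"
  using ce_vec_add[of p "axis y 1" "(-1) *\<^sub>R axis (1 - y) 1"]
    ce_vec_scaleR[of p "-1" "axis (1 - y) 1"]
  by (simp add: gls_limit_label_eq cl_loss_def ce_vec_one_hot)

lemma ce_vec_gls_label:
  assumes "r < 2"
  shows "ce_vec p (gls_label r y) / (1 - r / 2) = ce p y + r / (2 - r) * ce p (1 - y)"
proof -
  have "ce_vec p (gls_label r y) / (1 - r / 2) = ce_vec p (gls_label r y /\<^sub>R (1 - r / 2))"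
    by (simp only: ce_vec_scaleR divide_inverse_commute)
  then show ?thesis
    by (simp add: gls_label_scaled[OF assms] ce_vec_add ce_vec_scaleR ce_vec_one_hot)
qed

text \<open>The two entries are positive and sum to 1, so each is at most 1 and its logarithm is
  nonpositive. This provides the sign behind convergence from above.\<close>

lemma ce_nonneg:
  assumes "softmax_model M f" "x \<in> space M"
  shows "0 \<le> ce (f x) y"
proof -
  have pos: "0 < f x $ k" for k
    using assms by (simp add: softmax_model_def)
  have "f x $ y + f x $ (1 - y) = 1"
    using assms sum_label[of "\<lambda>k. f x $ k" y] by (simp add: softmax_model_def)
  then have "f x $ y \<le> 1"
    using pos[of "1 - y"] by simp
  then show ?thesis
    using pos by (simp add: ce_def)
qed

text \<open>The integrands agree pointwise, so this holds even where the integral is only the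
  default value 0. Equality as functions gives equal infima and equal sets of minimizers at
  once.\<close>

lemma gls_limit_risk_eq: "gls_limit_risk D = cl_risk D"
  by (rule ext) (simp add: gls_limit_risk_def cl_risk_def ce_vec_gls_limit_label)

lemma cl_risk_eq:
  assumes "integrable D (\<lambda>(x, y). ce (f x) y)" "integrable D (\<lambda>(x, y). ce (f x) (1 - y))"
  shows "cl_risk D f = (\<integral>(x, y). ce (f x) y \<partial>D) - (\<integral>(x, y). ce (f x) (1 - y) \<partial>D)"
  using Bochner_Integration.integral_diff[OF assms]
  by (simp add: cl_risk_def cl_loss_def case_prod_unfold)

text \<open>Integrability of both losses lets the integral split, leaving an expression affine in
  \<open>r / (2 - r)\<close> with coefficients free of \<open>r\<close>. The limit in
  \<open>r\<close> therefore needs no convergence theorem for integrals.\<close>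

lemma gls_risk_scaled:
  assumes "integrable D (\<lambda>(x, y). ce (f x) y)" "integrable D (\<lambda>(x, y). ce (f x) (1 - y))"
    and "r < 2"
  shows "gls_risk D r f / (1 - r / 2)
    = (\<integral>(x, y). ce (f x) y \<partial>D) + r / (2 - r) * (\<integral>(x, y). ce (f x) (1 - y) \<partial>D)"
proof -
  have "gls_risk D r f / (1 - r / 2)
      = (\<integral>z. ce_vec (f (fst z)) (gls_label r (snd z)) / (1 - r / 2) \<partial>D)"
    by (simp add: gls_risk_def case_prod_unfold)
  also have "\<dots> = (\<integral>z. ce (f (fst z)) (snd z) + r / (2 - r) * ce (f (fst z)) (1 - snd z) \<partial>D)"
    by (simp only: ce_vec_gls_label[OF \<open>r < 2\<close>])
  also have "\<dots> = (\<integral>z. ce (f (fst z)) (snd z) \<partial>D)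
      + (\<integral>z. r / (2 - r) * ce (f (fst z)) (1 - snd z) \<partial>D)"
    using assms(1,2)
    by (intro Bochner_Integration.integral_add integrable_mult_right)
      (simp_all add: case_prod_unfold)
  also have "(\<integral>z. r / (2 - r) * ce (f (fst z)) (1 - snd z) \<partial>D)
      = r / (2 - r) * (\<integral>z. ce (f (fst z)) (1 - snd z) \<partial>D)"
    by (rule integral_mult_right_zero)
  finally show ?thesis
    by (simp add: case_prod_unfold)
qed

theorem theorem5p3:
  fixes M :: "'x measure" and D :: "('x \<times> 2) measure" and F :: "('x \<Rightarrow> real^2) set"
  assumes "prob_space D"
    and "sets D = sets (M \<Otimes>\<^sub>M count_space UNIV)"
    and "\<And>f. f \<in> F \<Longrightarrow> softmax_model M f"
  shows "(\<forall>y. ((\<lambda>r. gls_label r y /\<^sub>R (1 - r / 2)) \<longlongrightarrow> gls_limit_label y) at_bot) \<and>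
    (INF f\<in>F. ereal (cl_risk D f)) = (INF f\<in>F. ereal (gls_limit_risk D f)) \<and>
    {f. is_arg_min (cl_risk D) (\<lambda>g. g \<in> F) f} =
      {f. is_arg_min (gls_limit_risk D) (\<lambda>g. g \<in> F) f} \<and>
    ((\<forall>f\<in>F. integrable D (\<lambda>(x, y). ce (f x) y) \<and> integrable D (\<lambda>(x, y). ce (f x) (1 - y))) \<longrightarrow>
      ((\<lambda>r. INF f\<in>F. ereal (gls_risk D r f / (1 - r / 2))) \<longlongrightarrow>
        (INF f\<in>F. ereal (cl_risk D f))) at_bot)"
proof (intro conjI impI)
  show "\<forall>y. ((\<lambda>r. gls_label r y /\<^sub>R (1 - r / 2)) \<longlongrightarrow> gls_limit_label y) at_bot"
    using gls_label_tendsto by (simp add: gls_limit_label_eq)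
  show "(INF f\<in>F. ereal (cl_risk D f)) = (INF f\<in>F. ereal (gls_limit_risk D f))"
    by (simp add: gls_limit_risk_eq)
  show "{f. is_arg_min (cl_risk D) (\<lambda>g. g \<in> F) f} =
      {f. is_arg_min (gls_limit_risk D) (\<lambda>g. g \<in> F) f}"
    by (simp add: gls_limit_risk_eq)
next
  assume int: "\<forall>f\<in>F. integrable D (\<lambda>(x, y). ce (f x) y)
      \<and> integrable D (\<lambda>(x, y). ce (f x) (1 - y))"
  define A where "A f = (\<integral>(x, y). ce (f x) y \<partial>D)" for f
  define B where "B f = (\<integral>(x, y). ce (f x) (1 - y) \<partial>D)" for f
  have cl: "cl_risk D f = A f - B f" if "f \<in> F" for f
    unfolding A_def B_def by (rule cl_risk_eq) (use int that in auto)
  have gls: "gls_risk D r f / (1 - r / 2) = A f + r / (2 - r) * B f"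
    if "f \<in> F" "r < 2" for f r
    unfolding A_def B_def by (rule gls_risk_scaled) (use int that in auto)
  \<comment> \<open>Softmax positivity is known only on \<open>space M\<close>, so points of
    \<open>D\<close> must be traced back to it.\<close>
  have space_D: "space D = space M \<times> UNIV"
    using sets_eq_imp_space_eq[OF assms(2)] by (simp add: space_pair_measure)
  have B_nonneg: "0 \<le> B f" if "f \<in> F" for f
    unfolding B_def using ce_nonneg[OF assms(3)[OF that]]
    by (intro Bochner_Integration.integral_nonneg) (auto simp: space_D)
  have small: "\<forall>\<^sub>F r::real in at_bot. r < 2"
    by (rule eventually_gt_at_bot)
  show "((\<lambda>r. INF f\<in>F. ereal (gls_risk D r f / (1 - r / 2))) \<longlongrightarrow>
        (INF f\<in>F. ereal (cl_risk D f))) at_bot"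
  proof (rule tendsto_INF_from_above)
    fix f assume f: "f \<in> F"
    have "((\<lambda>r. A f + r / (2 - r) * B f) \<longlongrightarrow> A f + (-1) * B f) at_bot"
      by (intro tendsto_intros gls_coeff_tendsto)
    then have lim: "((\<lambda>r. A f + r / (2 - r) * B f) \<longlongrightarrow> cl_risk D f) at_bot"
      by (simp add: cl[OF f])
    have "\<forall>\<^sub>F r in at_bot. A f + r / (2 - r) * B f = gls_risk D r f / (1 - r / 2)"
      using small by (rule eventually_mono) (simp add: gls[OF f])
    with lim have "((\<lambda>r. gls_risk D r f / (1 - r / 2)) \<longlongrightarrow> cl_risk D f) at_bot"
      by (rule Lim_transform_eventually)
    then show "((\<lambda>r. ereal (gls_risk D r f / (1 - r / 2))) \<longlongrightarrow> ereal (cl_risk D f)) at_bot"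
      by (rule tendsto_ereal)
  next
    show "\<forall>\<^sub>F r in at_bot. \<forall>f\<in>F. ereal (cl_risk D f) \<le> ereal (gls_risk D r f / (1 - r / 2))"
      using small
    proof (rule eventually_mono, intro ballI)
      fix r :: real and f assume r: "r < 2" and f: "f \<in> F"
      \<comment> \<open>Indeed \<open>r / (2 - r) + 1 = 2 / (2 - r)\<close>, so the rescaled risk
        exceeds \<open>cl_risk D f\<close> by the nonnegative amount
        \<open>2 / (2 - r) * B f\<close>.\<close>
      have "-1 \<le> r / (2 - r)"
        using r by (simp add: field_simps)
      from mult_right_mono[OF this B_nonneg[OF f]]
      show "ereal (cl_risk D f) \<le> ereal (gls_risk D r f / (1 - r / 2))"
        by (simp add: cl[OF f] gls[OF f r])
    qed
  qed
qed

end
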